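(* Let $\mathcal{G}=\langle \mathit{Init},\mathit{Safe},\mathit{Reach},\mathit{Goal}\rangle$ be a reachability game whose bisimilarity relation $\sim$ has finitely many equivalence classes $S_1,\ldots,S_n$, and assume each class $S_i$ is definable in $\mathcal{L}$, i.e., there is $\psi_i\in\mathcal{L}(\mathcal{V})$ such that for every state $s$, $\psi_i(s)$ holds iff $s\in S_i$. Assume further that the function $\operatorname{Interpolate}$ respects $\sim$, i.e., $\operatorname{Interpolate}(\alpha,\beta)$ is always equivalent to a disjunction of formulas $\psi_i$. Then the procedure $\operatorname{Reach}(\mathcal{G})$ (described in the context) terminates.
   Context: Setting. Fix a logic $\mathcal{L}$ and a finite set of variables $\mathcal{V}$ with domains, primed copies $\mathcal{V}'$, and a Boolean variable $\mathbf{r}\in\mathcal{V}$; $\varphi[\mathcal{V}/\mathcal{V}']$ primes all variables, $\varphi[\mathcal{V}'/\mathcal{V}]$ unprimes them. A state is a valuation of $\mathcal{V}$ respecting domains; $S$ is the set of states; $\varphi(s)$, $\tau(s,s')$ denote evaluation of state predicates (formulas over $\mathcal{V}$) and transition predicates (over $\mathcal{V}\cup\mathcal{V}'$). A reachability game $\langle \mathit{Init},\mathit{Safe},\mathit{Reach},\mathit{Goal}\rangle$ has state predicates $\mathit{Init},\mathit{Goal}$ and transition predicates $\mathit{Safe},\mathit{Reach}$ with $\mathit{Safe}\Rightarrow\neg\mathbf{r}$, $\mathit{Reach}\Rightarrow\mathbf{r}$ valid. A state $s$ is winning for REACH if REACH has a strategy guaranteeing a visit to a $\mathit{Goal}$ state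 on every play from $s$ (plays follow $\mathit{Safe}\lor\mathit{Reach}$, REACH moves in states with $\mathbf{r}$ true, SAFE in the others, and finite plays end in states without outgoing transitions). Satisfiability checks, interpolation, and quantifier elimination are treated as oracle calls that always return. Bisimulation. A relation $B\subseteq S\times S$ is a bisimulation on $\mathcal{G}$ if for all $(s_1,s_2)\in B$: $\mathit{Goal}(s_1)\Leftrightarrow\mathit{Goal}(s_2)$, $\mathit{Init}(s_1)\Leftrightarrow\mathit{Init}(s_2)$, $\mathbf{r}(s_1)\Leftrightarrow\mathbf{r}(s_2)$; for every $s_1'$ with $(\mathit{Safe}\lor\mathit{Reach})(s_1,s_1')$ there is $s_2'$ with $(\mathit{Safe}\lor\mathit{Reach})(s_2,s_2')$ and $(s_1',s_2')\in B$; and symmetrically for every $s_2'$ with $(\mathit{Safe}\lor\mathit{Reach})(s_2,s_2')$ there is $s_1'$ with $(\mathit{Safe}\lor\mathit{Reach})(s_1,s_1')$ and $(s_1',s_2')\in B$. Bisimilarity $\sim$: $s_1\sim s_2$ iff some bisimulation contains $(s_1,s_2)$; it is an equivalence relation. Operators. $\operatorname{Pre}(T)=\exists\mathcal{V}'.T$, $\operatorname{Post}(T)=\exists\mathcal{V}.T$, $\operatorname{Instantiate}(\varphi,\mathcal{G})=(\mathit{Safe}\lor\mathit{Reach})\land\neg\varphi\land\varphi[\mathcal{V}/\mathcal{V}']$, $\operatorname{Enf}(T,\mathcal{G})=(\mathit{Safe}\lor\mathit{Reach})\land T\land\neg\exists\mathcal{V}'.(\mathit{Safe}\land\neg T)$.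 $\operatorname{Interpolate}$ is a fixed function that, given formulas $\alpha,\beta$ with $\alpha\land\beta$ unsatisfiable, returns $\theta$ with $\beta\Rightarrow\theta$ valid, $\theta\land\alpha$ unsatisfiable, and only variables shared by $\alpha,\beta$. $\operatorname{combine}(A,F,B):=(\operatorname{Pre}(B)\Rightarrow B)\land((\neg\operatorname{Pre}(B)\land\operatorname{Pre}(F))\Rightarrow F)\land((\neg\operatorname{Pre}(B)\land\neg\operatorname{Pre}(F))\Rightarrow A)\land(\operatorname{Pre}(B)\lor\operatorname{Pre}(F)\lor\operatorname{Pre}(A))$. Procedure $\operatorname{Reach}(\mathcal{G})$ for $\mathcal{G}=\langle \mathit{Init},\mathit{Safe},\mathit{Reach},\mathit{Goal}\rangle$: (1) $R:=\mathit{Init}\land\mathit{Goal}$; $I:=\mathit{Init}\land\neg\mathit{Goal}$. (2) If $I$ is unsatisfiable, return $(R,\mathrm{false},\mathrm{false})$. (3) $\varphi:=\operatorname{Interpolate}(I,\mathit{Goal})$; $C:=\operatorname{Instantiate}(\varphi,\mathcal{G})$. (4) If $\operatorname{Enf}(C,\mathcal{G})$ is unsatisfiable, return $(R,\mathrm{false},\mathit{Safe}\land\neg C)$. (5) $\mathcal{G}_{post}:=\langle \operatorname{Post}(C)[\mathcal{V}'/\mathcal{V}],\mathit{Safe}\land\varphi,\mathit{Reach}\land\varphi,\mathit{Goal}\rangle$; $(R_{post},\mathfrak{S}^{post}_{\mathrm{REACH}},\mathfrak{S}^{post}_{\mathrm{SAFE}}):=\operatorname{Reach}(\mathcal{G}_{post})$.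 (6) $F:=C\land R_{post}[\mathcal{V}/\mathcal{V}']$. (7) If $\operatorname{Enf}(F,\mathcal{G})$ is unsatisfiable, return $(R,\mathrm{false},\mathit{Safe}\land\neg F\land(\varphi\Rightarrow\mathfrak{S}^{post}_{\mathrm{SAFE}}))$. (8) If $(\mathit{Reach}\lor\mathit{Safe})\land\varphi\land\neg\varphi[\mathcal{V}/\mathcal{V}']\land\neg\mathit{Goal}$ is satisfiable, set $F:=F\lor\mathit{Goal}[\mathcal{V}/\mathcal{V}']$ and $\varphi:=\mathrm{false}$. (9) $\mathcal{G}_{pre}:=\langle I,\mathit{Safe}\land\neg F,\mathit{Reach}\land\neg F,\operatorname{Pre}(\operatorname{Enf}(F,\mathcal{G}))\rangle$; $(R_{pre},\mathfrak{S}^{pre}_{\mathrm{REACH}},\mathfrak{S}^{pre}_{\mathrm{SAFE}}):=\operatorname{Reach}(\mathcal{G}_{pre})$. (10) Return $(R\lor R_{pre},\ \operatorname{combine}(\mathfrak{S}^{pre}_{\mathrm{REACH}},F,\mathfrak{S}^{post}_{\mathrm{REACH}}),\ (\neg\varphi\Rightarrow\mathfrak{S}^{pre}_{\mathrm{SAFE}})\land(\varphi\Rightarrow\mathfrak{S}^{post}_{\mathrm{SAFE}}))$. *)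

theory Defs
  imports Main
begin

datatype 'v pvar = Cur 'v | Nxt 'v

fun to_nxt :: "'v pvar \<Rightarrow> 'v pvar" where
  "to_nxt (Cur x) = Nxt x"
| "to_nxt (Nxt x) = Nxt x"

fun to_cur :: "'v pvar \<Rightarrow> 'v pvar" where
  "to_cur (Cur x) = Cur x"
| "to_cur (Nxt x) = Cur x"

text \<open>
  An arbitrary logic over the variables and their primed copies. The finite set of variables is
  the whole type \<open>'v\<close>; the type \<open>'f\<close> consists of the formulas of the logic over
  unprimed and primed variables. \<open>Exq X \<phi>\<close> is the formula that quantifier elimination returns
  for the existential quantification of \<open>\<phi>\<close> over all variables in \<open>X\<close>.
  \<open>tval\<close> and \<open>fval\<close> are the two values of the Boolean variable \<open>rvar\<close>.
\<close>

record ('v, 'd, 'f) logic =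
  vdom :: "'v \<Rightarrow> 'd set"
  rvar :: 'v
  tval :: 'd
  fval :: 'd
  fv :: "'f \<Rightarrow> 'v pvar set"
  sat :: "('v pvar \<Rightarrow> 'd) \<Rightarrow> 'f \<Rightarrow> bool"
  Fls :: 'f
  Neg :: "'f \<Rightarrow> 'f"
  Con :: "'f \<Rightarrow> 'f \<Rightarrow> 'f"
  Dis :: "'f \<Rightarrow> 'f \<Rightarrow> 'f"
  Exq :: "'v pvar set \<Rightarrow> 'f \<Rightarrow> 'f"
  Primed :: "'f \<Rightarrow> 'f"
  Unprimed :: "'f \<Rightarrow> 'f"

definition valuations :: "('v, 'd, 'f) logic \<Rightarrow> ('v pvar \<Rightarrow> 'd) set" where
  "valuations L = {\<sigma>. \<forall>x. \<sigma> (Cur x) \<in> vdom L x \<and> \<sigma> (Nxt x) \<in> vdom L x}"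

locale wf_logic =
  fixes L :: "('v::finite, 'd, 'f) logic"
  assumes rvar_Boolean: "vdom L (rvar L) = {tval L, fval L}" "tval L \<noteq> fval L"
    and sat_coincidence: "\<lbrakk>\<sigma> \<in> valuations L; \<sigma>' \<in> valuations L; \<And>x. x \<in> fv L \<phi> \<Longrightarrow> \<sigma> x = \<sigma>' x\<rbrakk> \<Longrightarrow>
          sat L \<sigma> \<phi> = sat L \<sigma>' \<phi>"
    and sat_Fls: "\<sigma> \<in> valuations L \<Longrightarrow> \<not> sat L \<sigma> (Fls L)"
    and sat_Neg: "\<sigma> \<in> valuations L \<Longrightarrow> sat L \<sigma> (Neg L \<phi>) \<longleftrightarrow> \<not> sat L \<sigma> \<phi>"
    and sat_Con: "\<sigma> \<in> valuations L \<Longrightarrow> sat L \<sigma> (Con L \<phi> \<chi>) \<longleftrightarrow> sat L \<sigma> \<phi> \<and> sat L \<sigma> \<chi>"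
    and sat_Dis: "\<sigma> \<in> valuations L \<Longrightarrow> sat L \<sigma> (Dis L \<phi> \<chi>) \<longleftrightarrow> sat L \<sigma> \<phi> \<or> sat L \<sigma> \<chi>"
    and sat_Exq: "\<sigma> \<in> valuations L \<Longrightarrow>
          sat L \<sigma> (Exq L X \<phi>) \<longleftrightarrow> (\<exists>\<sigma>'\<in>valuations L. (\<forall>x. x \<notin> X \<longrightarrow> \<sigma>' x = \<sigma> x) \<and> sat L \<sigma>' \<phi>)"
    and sat_Primed: "\<sigma> \<in> valuations L \<Longrightarrow> sat L \<sigma> (Primed L \<phi>) \<longleftrightarrow> sat L (\<sigma> \<circ> to_nxt) \<phi>"
    and sat_Unprimed: "\<sigma> \<in> valuations L \<Longrightarrow> sat L \<sigma> (Unprimed L \<phi>) \<longleftrightarrow> sat L (\<sigma> \<circ> to_cur) \<phi>"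
    and fv_Fls: "fv L (Fls L) = {}"
    and fv_Neg: "fv L (Neg L \<phi>) \<subseteq> fv L \<phi>"
    and fv_Con: "fv L (Con L \<phi> \<chi>) \<subseteq> fv L \<phi> \<union> fv L \<chi>"
    and fv_Dis: "fv L (Dis L \<phi> \<chi>) \<subseteq> fv L \<phi> \<union> fv L \<chi>"
    and fv_Exq: "fv L (Exq L X \<phi>) \<subseteq> fv L \<phi> - X"
    and fv_Primed: "fv L (Primed L \<phi>) \<subseteq> to_nxt ` fv L \<phi>"
    and fv_Unprimed: "fv L (Unprimed L \<phi>) \<subseteq> to_cur ` fv L \<phi>"

definition Imp :: "('v, 'd, 'f) logic \<Rightarrow> 'f \<Rightarrow> 'f \<Rightarrow> 'f" where
  "Imp L \<phi> \<chi> = Dis L (Neg L \<phi>) \<chi>"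

definition BigDis :: "('v, 'd, 'f) logic \<Rightarrow> 'f list \<Rightarrow> 'f" where
  "BigDis L \<phi>s = foldr (Dis L) \<phi>s (Fls L)"

definition unsat :: "('v, 'd, 'f) logic \<Rightarrow> 'f \<Rightarrow> bool" where
  "unsat L \<phi> \<longleftrightarrow> (\<forall>\<sigma>\<in>valuations L. \<not> sat L \<sigma> \<phi>)"

definition valid :: "('v, 'd, 'f) logic \<Rightarrow> 'f \<Rightarrow> bool" where
  "valid L \<phi> \<longleftrightarrow> (\<forall>\<sigma>\<in>valuations L. sat L \<sigma> \<phi>)"

definition equivalent :: "('v, 'd, 'f) logic \<Rightarrow> 'f \<Rightarrow> 'f \<Rightarrow> bool" where
  "equivalent L \<phi> \<chi> \<longleftrightarrow> (\<forall>\<sigma>\<in>valuations L. sat L \<sigma> \<phi> \<longleftrightarrow> sat L \<sigma> \<chi>)"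

definition states :: "('v, 'd, 'f) logic \<Rightarrow> ('v \<Rightarrow> 'd) set" where
  "states L = {s. \<forall>x. s x \<in> vdom L x}"

definition state_pred :: "('v, 'd, 'f) logic \<Rightarrow> 'f \<Rightarrow> bool" where
  "state_pred L \<phi> \<longleftrightarrow> fv L \<phi> \<subseteq> range Cur"

definition trans_eval :: "('v, 'd, 'f) logic \<Rightarrow> 'f \<Rightarrow> ('v \<Rightarrow> 'd) \<Rightarrow> ('v \<Rightarrow> 'd) \<Rightarrow> bool" where
  "trans_eval L \<tau> s s' \<longleftrightarrow> sat L (case_pvar s s') \<tau>"

text \<open>State predicates do not depend on the values of the primed variables.\<close>

definition state_eval :: "('v, 'd, 'f) logic \<Rightarrow> 'f \<Rightarrow> ('v \<Rightarrow> 'd) \<Rightarrow> bool" where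
  "state_eval L \<phi> s \<longleftrightarrow> sat L (case_pvar s s) \<phi>"

definition r_holds :: "('v, 'd, 'f) logic \<Rightarrow> ('v \<Rightarrow> 'd) \<Rightarrow> bool" where
  "r_holds L s \<longleftrightarrow> s (rvar L) = tval L"

record 'f game =
  Init :: 'f
  Safe :: 'f
  Reach :: 'f
  Goal :: 'f

definition moves :: "('v, 'd, 'f) logic \<Rightarrow> 'f game \<Rightarrow> 'f" where
  "moves L G = Dis L (Safe G) (Reach G)"

definition reachability_game :: "('v, 'd, 'f) logic \<Rightarrow> 'f game \<Rightarrow> bool" where
  "reachability_game L G \<longleftrightarrow>
     state_pred L (Init G) \<and> state_pred L (Goal G) \<and>
     (\<forall>s\<in>states L. \<forall>s'\<in>states L. trans_eval L (Safe G) s s' \<longrightarrow> \<not> r_holds L s) \<and>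
     (\<forall>s\<in>states L. \<forall>s'\<in>states L. trans_eval L (Reach G) s s' \<longrightarrow> r_holds L s)"

definition bisimulation ::
    "('v, 'd, 'f) logic \<Rightarrow> 'f game \<Rightarrow> (('v \<Rightarrow> 'd) \<times> ('v \<Rightarrow> 'd)) set \<Rightarrow> bool" where
  "bisimulation L G B \<longleftrightarrow> B \<subseteq> states L \<times> states L \<and>
     (\<forall>(s1, s2)\<in>B.
        (state_eval L (Goal G) s1 \<longleftrightarrow> state_eval L (Goal G) s2) \<and>
        (state_eval L (Init G) s1 \<longleftrightarrow> state_eval L (Init G) s2) \<and>
        (r_holds L s1 \<longleftrightarrow> r_holds L s2) \<and>
        (\<forall>s1'\<in>states L. trans_eval L (moves L G) s1 s1' \<longrightarrow>
           (\<exists>s2'\<in>states L. trans_eval L (moves L G) s2 s2' \<and> (s1', s2') \<in> B)) \<and>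
        (\<forall>s2'\<in>states L. trans_eval L (moves L G) s2 s2' \<longrightarrow>
           (\<exists>s1'\<in>states L. trans_eval L (moves L G) s1 s1' \<and> (s1', s2') \<in> B)))"

definition bisimilarity ::
    "('v, 'd, 'f) logic \<Rightarrow> 'f game \<Rightarrow> (('v \<Rightarrow> 'd) \<times> ('v \<Rightarrow> 'd)) set" where
  "bisimilarity L G = {(s1, s2). \<exists>B. bisimulation L G B \<and> (s1, s2) \<in> B}"

definition Pre :: "('v, 'd, 'f) logic \<Rightarrow> 'f \<Rightarrow> 'f" where
  "Pre L T = Exq L (range Nxt) T"

definition Post :: "('v, 'd, 'f) logic \<Rightarrow> 'f \<Rightarrow> 'f" where
  "Post L T = Exq L (range Cur) T"

definition Instantiate :: "('v, 'd, 'f) logic \<Rightarrow> 'f \<Rightarrow> 'f game \<Rightarrow> 'f" where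
  "Instantiate L \<phi> G = Con L (Con L (moves L G) (Neg L \<phi>)) (Primed L \<phi>)"

definition Enf :: "('v, 'd, 'f) logic \<Rightarrow> 'f \<Rightarrow> 'f game \<Rightarrow> 'f" where
  "Enf L T G =
     Con L (Con L (moves L G) T) (Neg L (Exq L (range Nxt) (Con L (Safe G) (Neg L T))))"

definition interpolation :: "('v, 'd, 'f) logic \<Rightarrow> ('f \<Rightarrow> 'f \<Rightarrow> 'f) \<Rightarrow> bool" where
  "interpolation L itp \<longleftrightarrow>
     (\<forall>\<alpha> \<beta>. unsat L (Con L \<alpha> \<beta>) \<longrightarrow>
        valid L (Imp L \<beta> (itp \<alpha> \<beta>)) \<and> unsat L (Con L (itp \<alpha> \<beta>) \<alpha>) \<and>
        fv L (itp \<alpha> \<beta>) \<subseteq> fv L \<alpha> \<inter> fv L \<beta>)"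

definition combine :: "('v, 'd, 'f) logic \<Rightarrow> 'f \<Rightarrow> 'f \<Rightarrow> 'f \<Rightarrow> 'f" where
  "combine L A F B =
     Con L (Con L (Con L
       (Imp L (Pre L B) B)
       (Imp L (Con L (Neg L (Pre L B)) (Pre L F)) F))
       (Imp L (Con L (Neg L (Pre L B)) (Neg L (Pre L F))) A))
       (Dis L (Dis L (Pre L B) (Pre L F)) (Pre L A))"

text \<open>
  The values computed by the procedure on a game \<open>G\<close>. Those computed after the first recursive
  call take the formula \<open>Rp\<close> returned by that call as an additional argument; \<open>F_fin\<close> and
  \<open>phi_fin\<close> are the values of \<open>F\<close> and \<open>\<phi>\<close> after their conditional reassignment.
\<close>

definition R_init :: "('v, 'd, 'f) logic \<Rightarrow> 'f game \<Rightarrow> 'f" where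
  "R_init L G = Con L (Init G) (Goal G)"

definition I_init :: "('v, 'd, 'f) logic \<Rightarrow> 'f game \<Rightarrow> 'f" where
  "I_init L G = Con L (Init G) (Neg L (Goal G))"

definition phi_itp :: "('v, 'd, 'f) logic \<Rightarrow> ('f \<Rightarrow> 'f \<Rightarrow> 'f) \<Rightarrow> 'f game \<Rightarrow> 'f" where
  "phi_itp L itp G = itp (I_init L G) (Goal G)"

definition C_sub :: "('v, 'd, 'f) logic \<Rightarrow> ('f \<Rightarrow> 'f \<Rightarrow> 'f) \<Rightarrow> 'f game \<Rightarrow> 'f" where
  "C_sub L itp G = Instantiate L (phi_itp L itp G) G"

definition G_post :: "('v, 'd, 'f) logic \<Rightarrow> ('f \<Rightarrow> 'f \<Rightarrow> 'f) \<Rightarrow> 'f game \<Rightarrow> 'f game" where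
  "G_post L itp G =
     \<lparr>Init = Unprimed L (Post L (C_sub L itp G)),
      Safe = Con L (Safe G) (phi_itp L itp G),
      Reach = Con L (Reach G) (phi_itp L itp G),
      Goal = Goal G\<rparr>"

definition F_sub :: "('v, 'd, 'f) logic \<Rightarrow> ('f \<Rightarrow> 'f \<Rightarrow> 'f) \<Rightarrow> 'f game \<Rightarrow> 'f \<Rightarrow> 'f" where
  "F_sub L itp G Rp = Con L (C_sub L itp G) (Primed L Rp)"

definition phi_left :: "('v, 'd, 'f) logic \<Rightarrow> ('f \<Rightarrow> 'f \<Rightarrow> 'f) \<Rightarrow> 'f game \<Rightarrow> bool" where
  "phi_left L itp G \<longleftrightarrow>
     \<not> unsat L (Con L (Con L (Con L (Dis L (Reach G) (Safe G)) (phi_itp L itp G))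
                  (Neg L (Primed L (phi_itp L itp G)))) (Neg L (Goal G)))"

definition F_fin :: "('v, 'd, 'f) logic \<Rightarrow> ('f \<Rightarrow> 'f \<Rightarrow> 'f) \<Rightarrow> 'f game \<Rightarrow> 'f \<Rightarrow> 'f" where
  "F_fin L itp G Rp =
     (if phi_left L itp G then Dis L (F_sub L itp G Rp) (Primed L (Goal G)) else F_sub L itp G Rp)"

definition phi_fin :: "('v, 'd, 'f) logic \<Rightarrow> ('f \<Rightarrow> 'f \<Rightarrow> 'f) \<Rightarrow> 'f game \<Rightarrow> 'f" where
  "phi_fin L itp G = (if phi_left L itp G then Fls L else phi_itp L itp G)"

definition G_pre :: "('v, 'd, 'f) logic \<Rightarrow> ('f \<Rightarrow> 'f \<Rightarrow> 'f) \<Rightarrow> 'f game \<Rightarrow> 'f \<Rightarrow> 'f game" where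
  "G_pre L itp G Rp =
     \<lparr>Init = I_init L G,
      Safe = Con L (Safe G) (Neg L (F_fin L itp G Rp)),
      Reach = Con L (Reach G) (Neg L (F_fin L itp G Rp)),
      Goal = Pre L (Enf L (F_fin L itp G Rp) G)\<rparr>"

text \<open>
  Big-step semantics of the procedure: \<open>reach_run L itp G res\<close> holds iff the execution on \<open>G\<close>
  terminates with result \<open>res\<close>. Satisfiability checks, interpolation and quantifier elimination
  count as single steps. The procedure is deterministic (see \<open>reach_run_det\<close>) and exactly one
  branch applies at each point, so it terminates on \<open>G\<close> iff some \<open>res\<close> is derivable.
\<close>

inductive reach_run ::
    "('v, 'd, 'f) logic \<Rightarrow> ('f \<Rightarrow> 'f \<Rightarrow> 'f) \<Rightarrow> 'f game \<Rightarrow> 'f \<times> 'f \<times> 'f \<Rightarrow> bool"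
  for L itp where
  no_init:
    "unsat L (I_init L G)
     \<Longrightarrow> reach_run L itp G (R_init L G, Fls L, Fls L)"
| no_enf_C:
    "\<lbrakk>\<not> unsat L (I_init L G);
      unsat L (Enf L (C_sub L itp G) G)\<rbrakk>
     \<Longrightarrow> reach_run L itp G (R_init L G, Fls L, Con L (Safe G) (Neg L (C_sub L itp G)))"
| no_enf_F:
    "\<lbrakk>\<not> unsat L (I_init L G);
      \<not> unsat L (Enf L (C_sub L itp G) G);
      reach_run L itp (G_post L itp G) (Rpost, SRpost, SSpost);
      unsat L (Enf L (F_sub L itp G Rpost) G)\<rbrakk>
     \<Longrightarrow> reach_run L itp G
           (R_init L G, Fls L,
            Con L (Con L (Safe G) (Neg L (F_sub L itp G Rpost)))
              (Imp L (phi_itp L itp G) SSpost))"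
| recurse:
    "\<lbrakk>\<not> unsat L (I_init L G);
      \<not> unsat L (Enf L (C_sub L itp G) G);
      reach_run L itp (G_post L itp G) (Rpost, SRpost, SSpost);
      \<not> unsat L (Enf L (F_sub L itp G Rpost) G);
      reach_run L itp (G_pre L itp G Rpost) (Rpre, SRpre, SSpre)\<rbrakk>
     \<Longrightarrow> reach_run L itp G
           (Dis L (R_init L G) Rpre,
            combine L SRpre (F_fin L itp G Rpost) SRpost,
            Con L (Imp L (Neg L (phi_fin L itp G)) SSpre) (Imp L (phi_fin L itp G) SSpost))"

lemma reach_run_det:
  "reach_run L itp G res \<Longrightarrow> reach_run L itp G res' \<Longrightarrow> res = res'"
proof (induction arbitrary: res' rule: reach_run.induct)
  case (no_init G)
  then show ?case by (auto elim: reach_run.cases)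
next
  case (no_enf_C G)
  from no_enf_C.prems no_enf_C.hyps show ?case by cases auto
next
  case (no_enf_F G Rpost SRpost SSpost)
  from no_enf_F.prems no_enf_F.hyps show ?case
    by cases (auto dest: no_enf_F.IH)
next
  case (recurse G Rpost SRpost SSpost Rpre SRpre SSpre)
  from recurse.prems show ?case
  proof cases
    case (recurse Rpost' SRpost' SSpost' Rpre' SRpre' SSpre')
    then show ?thesis using recurse.IH by blast
  qed (use recurse.hyps recurse.IH in blast)+
qed

text \<open>The recursive calls that an execution on the first game directly makes.\<close>

inductive rec_call ::
    "('v, 'd, 'f) logic \<Rightarrow> ('f \<Rightarrow> 'f \<Rightarrow> 'f) \<Rightarrow> 'f game \<Rightarrow> 'f game \<Rightarrow> bool"
  for L itp where
  post:
    "\<lbrakk>\<not> unsat L (I_init L G);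
      \<not> unsat L (Enf L (C_sub L itp G) G)\<rbrakk>
     \<Longrightarrow> rec_call L itp G (G_post L itp G)"
| pre:
    "\<lbrakk>\<not> unsat L (I_init L G);
      \<not> unsat L (Enf L (C_sub L itp G) G);
      reach_run L itp (G_post L itp G) (Rpost, SRpost, SSpost);
      \<not> unsat L (Enf L (F_sub L itp G Rpost) G)\<rbrakk>
     \<Longrightarrow> rec_call L itp G (G_pre L itp G Rpost)"

text \<open>The pairs on which \<open>itp\<close> is called during the (possibly infinite) execution on \<open>G\<close>.\<close>

definition itp_call ::
    "('v, 'd, 'f) logic \<Rightarrow> ('f \<Rightarrow> 'f \<Rightarrow> 'f) \<Rightarrow> 'f game \<Rightarrow> 'f \<Rightarrow> 'f \<Rightarrow> bool" where
  "itp_call L itp G \<alpha> \<beta> \<longleftrightarrow>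
     (\<exists>G'. (rec_call L itp)\<^sup>*\<^sup>* G G' \<and> \<not> unsat L (I_init L G') \<and> \<alpha> = I_init L G' \<and> \<beta> = Goal G')"

definition disjunction_of :: "('v, 'd, 'f) logic \<Rightarrow> 'f set \<Rightarrow> 'f \<Rightarrow> bool" where
  "disjunction_of L \<Psi> \<theta> \<longleftrightarrow> (\<exists>\<psi>s. set \<psi>s \<subseteq> \<Psi> \<and> equivalent L \<theta> (BigDis L \<psi>s))"

text \<open>
  Interpolants are always disjunctions of formulas in \<open>\<Psi>\<close>, where ``always'' means: in all calls
  made by the procedure. Demanding this for all pairs of disjoint state predicates would force
  every state predicate \<open>\<alpha>\<close> to be such a disjunction (take \<open>\<beta>\<close> to be its negation), hence
  exclude all logics that distinguish two bisimilar states. The lemma below shows that the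
  demand for all pairs is a special case.
\<close>

definition itp_respects ::
    "('v, 'd, 'f) logic \<Rightarrow> ('f \<Rightarrow> 'f \<Rightarrow> 'f) \<Rightarrow> 'f game \<Rightarrow> 'f set \<Rightarrow> bool" where
  "itp_respects L itp G \<Psi> \<longleftrightarrow> (\<forall>\<alpha> \<beta>. itp_call L itp G \<alpha> \<beta> \<longrightarrow> disjunction_of L \<Psi> (itp \<alpha> \<beta>))"

context wf_logic
begin

lemma unsat_I_Goal: "unsat L (Con L (I_init L G) (Goal G))"
  by (auto simp: unsat_def I_init_def sat_Con sat_Neg)

lemma state_pred_Con: "state_pred L \<phi> \<Longrightarrow> state_pred L \<chi> \<Longrightarrow> state_pred L (Con L \<phi> \<chi>)"
  using fv_Con[of \<phi> \<chi>] by (auto simp: state_pred_def)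

lemma state_pred_Neg: "state_pred L \<phi> \<Longrightarrow> state_pred L (Neg L \<phi>)"
  using fv_Neg[of \<phi>] by (auto simp: state_pred_def)

lemma state_pred_Unprimed: "state_pred L (Unprimed L \<phi>)"
proof -
  have "to_cur x \<in> range Cur" for x :: "'v pvar" by (cases x) auto
  then show ?thesis using fv_Unprimed[of \<phi>] by (auto simp: state_pred_def)
qed

lemma state_pred_Pre: "state_pred L (Pre L \<phi>)"
proof -
  have "x \<in> range Cur \<or> x \<in> range Nxt" for x :: "'v pvar" by (cases x) auto
  then show ?thesis using fv_Exq[of "range Nxt" \<phi>] unfolding state_pred_def Pre_def by blast
qed

lemma rec_call_state_pred:
  assumes "rec_call L itp G G'" "state_pred L (Init G)" "state_pred L (Goal G)"
  shows "state_pred L (Init G') \<and> state_pred L (Goal G')"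
  using assms
  by (induction rule: rec_call.induct)
    (auto simp: G_post_def G_pre_def I_init_def
      intro: state_pred_Con state_pred_Neg state_pred_Unprimed state_pred_Pre)

lemma itp_respects_if_all_pairs:
  assumes G: "reachability_game L G"
    and all: "\<And>\<alpha> \<beta>. \<lbrakk>state_pred L \<alpha>; state_pred L \<beta>; unsat L (Con L \<alpha> \<beta>)\<rbrakk>
                \<Longrightarrow> disjunction_of L \<Psi> (itp \<alpha> \<beta>)"
  shows "itp_respects L itp G \<Psi>"
proof -
  have "state_pred L (Init G') \<and> state_pred L (Goal G')" if "(rec_call L itp)\<^sup>*\<^sup>* G G'" for G'
    using that
  proof (induction rule: rtranclp_induct)
    case base
    then show ?case using G by (simp add: reachability_game_def)
  next
    case (step G' G'')
    then show ?case using rec_call_state_pred by blast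
  qed
  then show ?thesis
    by (auto simp: itp_respects_def itp_call_def I_init_def unsat_I_Goal[unfolded I_init_def]
        intro!: all state_pred_Con state_pred_Neg)
qed

end

end

theory Submission
  imports Defs
begin

text \<open>
  Count the pairs of bisimilarity classes that are joined by a move. The post call keeps only
  moves that start in \<open>\<phi>\<close>, which loses the class pairs of \<open>C\<close>; the pre call deletes the moves in
  \<open>F\<close>. Both \<open>C\<close> and \<open>F\<close> are nonempty when the respective call is made, so the count drops,
  provided a class pair is deleted as soon as one of its moves is.

  The difficulty is that the initial condition of the post game is a forward image and hence
  need not be a union of classes, so bisimilarity is in general not a bisimulation on the
  subgames. But the returned formula \<open>R\<close> is always the conjunction of the initial condition with
  a union of classes, and the target of a move in \<open>C\<close> always satisfies the initial condition of
  the post game. So whether a move belongs to \<open>F\<close> depends only on the classes of its end points.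
\<close>

section \<open>Evaluating formulas on pairs of states\<close>

context wf_logic
begin

lemma case_pvar_in_valuations [simp]:
  "case_pvar s s' \<in> valuations L \<longleftrightarrow> s \<in> states L \<and> s' \<in> states L"
  by (auto simp: valuations_def states_def)

lemma valuation_cases:
  assumes "\<sigma> \<in> valuations L"
  obtains s s' where "s \<in> states L" "s' \<in> states L" "\<sigma> = case_pvar s s'"
proof
  show "\<sigma> = case_pvar (\<sigma> \<circ> Cur) (\<sigma> \<circ> Nxt)"
    by (auto split: pvar.split)
qed (use assms in \<open>auto simp: valuations_def states_def\<close>)

lemma trans_eval_simps:
  assumes "s \<in> states L" "s' \<in> states L"
  shows "\<not> trans_eval L (Fls L) s s'"
    and "trans_eval L (Neg L \<phi>) s s' \<longleftrightarrow> \<not> trans_eval L \<phi> s s'"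
    and "trans_eval L (Con L \<phi> \<chi>) s s' \<longleftrightarrow> trans_eval L \<phi> s s' \<and> trans_eval L \<chi> s s'"
    and "trans_eval L (Dis L \<phi> \<chi>) s s' \<longleftrightarrow> trans_eval L \<phi> s s' \<or> trans_eval L \<chi> s s'"
  using assms by (auto simp: trans_eval_def sat_Fls sat_Neg sat_Con sat_Dis)

lemma state_eval_eq_trans_eval: "state_eval L \<phi> s \<longleftrightarrow> trans_eval L \<phi> s s"
  by (simp add: state_eval_def trans_eval_def)

lemma trans_eval_Primed:
  assumes "s \<in> states L" "s' \<in> states L"
  shows "trans_eval L (Primed L \<phi>) s s' \<longleftrightarrow> state_eval L \<phi> s'"
proof -
  have "case_pvar s s' \<circ> to_nxt = case_pvar s' s'"
    by (rule ext) (auto split: pvar.split simp: comp_def)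
  then show ?thesis
    using assms by (simp add: trans_eval_def state_eval_def sat_Primed)
qed

lemma trans_eval_Exq_Nxt:
  assumes "s \<in> states L" "s' \<in> states L"
  shows "trans_eval L (Exq L (range Nxt) \<phi>) s s' \<longleftrightarrow> (\<exists>t\<in>states L. trans_eval L \<phi> s t)"
proof
  assume "trans_eval L (Exq L (range Nxt) \<phi>) s s'"
  then obtain \<sigma> where \<sigma>: "\<sigma> \<in> valuations L" "\<forall>x. x \<notin> range Nxt \<longrightarrow> \<sigma> x = case_pvar s s' x" "sat L \<sigma> \<phi>"
    using assms by (auto simp: trans_eval_def sat_Exq)
  obtain u t where ut: "t \<in> states L" "\<sigma> = case_pvar u t"
    using \<sigma>(1) by (rule valuation_cases)
  have "u x = s x" for x
    using \<sigma>(2)[rule_format, of "Cur x"] ut by auto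
  then have "u = s" by auto
  then show "\<exists>t\<in>states L. trans_eval L \<phi> s t"
    using \<sigma>(3) ut by (auto simp: trans_eval_def)
next
  assume "\<exists>t\<in>states L. trans_eval L \<phi> s t"
  then obtain t where "t \<in> states L" "trans_eval L \<phi> s t" by blast
  then show "trans_eval L (Exq L (range Nxt) \<phi>) s s'"
    using assms unfolding trans_eval_def
    by (subst sat_Exq) (auto intro!: bexI[of _ "case_pvar s t"] split: pvar.split)
qed

text \<open>\<open>Post\<close> quantifies the unprimed copy away and so speaks of the target of a
  transition; unpriming then feeds the state \<open>s\<close> into that target position, and the
  source \<open>t\<close> is the quantified witness.\<close>

lemma state_eval_Unprimed_Post:
  assumes "s \<in> states L"
  shows "state_eval L (Unprimed L (Post L \<phi>)) s \<longleftrightarrow> (\<exists>t\<in>states L. trans_eval L \<phi> t s)"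
proof -
  \<comment> \<open>When both copies hold the same state, unpriming does not change the
    valuation.\<close>
  have c: "case_pvar s s \<circ> to_cur = case_pvar s s"
    by (rule ext) (auto split: pvar.split simp: comp_def)
  show ?thesis
  proof
    assume "state_eval L (Unprimed L (Post L \<phi>)) s"
    then obtain \<sigma> where \<sigma>: "\<sigma> \<in> valuations L" "\<forall>x. x \<notin> range Cur \<longrightarrow> \<sigma> x = case_pvar s s x" "sat L \<sigma> \<phi>"
      using assms by (auto simp: state_eval_def sat_Unprimed c Post_def sat_Exq)
    obtain t u where ut: "t \<in> states L" "\<sigma> = case_pvar t u"
      using \<sigma>(1) by (rule valuation_cases)
    have "u x = s x" for x
      using \<sigma>(2)[rule_format, of "Nxt x"] ut by auto
    then have "u = s" by auto
    then show "\<exists>t\<in>states L. trans_eval L \<phi> t s"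
      using \<sigma>(3) ut by (auto simp: trans_eval_def)
  next
    assume "\<exists>t\<in>states L. trans_eval L \<phi> t s"
    then obtain t where "t \<in> states L" "trans_eval L \<phi> t s" by blast
    then have "sat L (case_pvar s s) (Exq L (range Cur) \<phi>)"
      using assms unfolding trans_eval_def
      by (subst sat_Exq) (auto intro!: bexI[of _ "case_pvar t s"] split: pvar.split)
    then show "state_eval L (Unprimed L (Post L \<phi>)) s"
      using assms by (simp add: state_eval_def sat_Unprimed c Post_def)
  qed
qed

lemma not_unsatE:
  assumes "\<not> unsat L \<phi>"
  obtains s s' where "s \<in> states L" "s' \<in> states L" "trans_eval L \<phi> s s'"
  using assms unfolding unsat_def trans_eval_def by (metis valuation_cases)

lemma sat_BigDis:
  assumes "\<sigma> \<in> valuations L"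
  shows "sat L \<sigma> (BigDis L \<phi>s) \<longleftrightarrow> (\<exists>\<phi>\<in>set \<phi>s. sat L \<sigma> \<phi>)"
  using assms by (induction \<phi>s) (auto simp: BigDis_def sat_Fls sat_Dis)

lemma trans_eval_state_pred:
  assumes "state_pred L \<phi>" "s \<in> states L" "s' \<in> states L"
  shows "trans_eval L \<phi> s s' \<longleftrightarrow> state_eval L \<phi> s"
  unfolding trans_eval_def state_eval_def
  by (rule sat_coincidence) (use assms in \<open>auto simp: state_pred_def\<close>)

lemma trans_eval_moves:
  assumes "s \<in> states L" "s' \<in> states L"
  shows "trans_eval L (moves L G) s s' \<longleftrightarrow> trans_eval L (Safe G) s s' \<or> trans_eval L (Reach G) s s'"
  using assms by (simp add: moves_def trans_eval_simps)

lemma trans_eval_Enf: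
  assumes "s \<in> states L" "s' \<in> states L"
  shows "trans_eval L (Enf L T G) s s' \<longleftrightarrow>
    trans_eval L (moves L G) s s' \<and> trans_eval L T s s' \<and>
    (\<forall>u\<in>states L. trans_eval L (Safe G) s u \<longrightarrow> trans_eval L T s u)"
  using assms by (auto simp: Enf_def trans_eval_simps trans_eval_Exq_Nxt)

end

section \<open>Bisimilarity is itself a bisimulation and an equivalence relation\<close>

text \<open>Bisimilarity is the union of all bisimulations, and the relation occurs only positively
  in the matching clauses, so a match found inside one bisimulation is also a match in the
  union.\<close>

lemma bisimulation_bisimilarity: "bisimulation L G (bisimilarity L G)"
proof -
  have mono: "B \<subseteq> bisimilarity L G" if "bisimulation L G B" for B
    using that by (auto simp: bisimilarity_def)
  show ?thesis
    unfolding bisimulation_def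
  proof (intro conjI ballI)
    show "bisimilarity L G \<subseteq> states L \<times> states L"
      by (auto simp: bisimilarity_def bisimulation_def)
  next
    fix p assume "p \<in> bisimilarity L G"
    then obtain s t B where p: "p = (s, t)" "(s, t) \<in> B" and B: "bisimulation L G B"
      unfolding bisimilarity_def by blast
    note b = bspec[OF B[unfolded bisimulation_def, THEN conjunct2] p(2), unfolded split]
    have fwd: "\<exists>t'\<in>states L. trans_eval L (moves L G) t t' \<and> (s', t') \<in> bisimilarity L G"
      if "s' \<in> states L" "trans_eval L (moves L G) s s'" for s'
      using b mono[OF B] that by (meson subsetD)
    have bwd: "\<exists>s'\<in>states L. trans_eval L (moves L G) s s' \<and> (s', t') \<in> bisimilarity L G"
      if "t' \<in> states L" "trans_eval L (moves L G) t t'" for t'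
      using b mono[OF B] that by (meson subsetD)
    show "case p of (s1, s2) \<Rightarrow>
        (state_eval L (Goal G) s1 \<longleftrightarrow> state_eval L (Goal G) s2) \<and>
        (state_eval L (Init G) s1 \<longleftrightarrow> state_eval L (Init G) s2) \<and>
        (r_holds L s1 \<longleftrightarrow> r_holds L s2) \<and>
        (\<forall>s1'\<in>states L. trans_eval L (moves L G) s1 s1' \<longrightarrow>
           (\<exists>s2'\<in>states L. trans_eval L (moves L G) s2 s2' \<and> (s1', s2') \<in> bisimilarity L G)) \<and>
        (\<forall>s2'\<in>states L. trans_eval L (moves L G) s2 s2' \<longrightarrow>
           (\<exists>s1'\<in>states L. trans_eval L (moves L G) s1 s1' \<and> (s1', s2') \<in> bisimilarity L G))"
      using b fwd bwd unfolding p(1) by simp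
  qed
qed

lemma bisimulation_Id_on: "bisimulation L G (Id_on (states L))"
  by (auto simp: bisimulation_def)

lemma bisimulation_converse:
  assumes "bisimulation L G B"
  shows "bisimulation L G (B\<inverse>)"
  unfolding bisimulation_def
proof (intro conjI ballI)
  show "B\<inverse> \<subseteq> states L \<times> states L"
    using assms by (auto simp: bisimulation_def)
next
  fix p assume "p \<in> B\<inverse>"
  then obtain s t where p: "p = (t, s)" and st: "(s, t) \<in> B"
    by auto
  note b = bspec[OF assms[unfolded bisimulation_def, THEN conjunct2] st, unfolded split]
  show "case p of (s1, s2) \<Rightarrow>
        (state_eval L (Goal G) s1 \<longleftrightarrow> state_eval L (Goal G) s2) \<and>
        (state_eval L (Init G) s1 \<longleftrightarrow> state_eval L (Init G) s2) \<and>
        (r_holds L s1 \<longleftrightarrow> r_holds L s2) \<and>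
        (\<forall>s1'\<in>states L. trans_eval L (moves L G) s1 s1' \<longrightarrow>
           (\<exists>s2'\<in>states L. trans_eval L (moves L G) s2 s2' \<and> (s1', s2') \<in> B\<inverse>)) \<and>
        (\<forall>s2'\<in>states L. trans_eval L (moves L G) s2 s2' \<longrightarrow>
           (\<exists>s1'\<in>states L. trans_eval L (moves L G) s1 s1' \<and> (s1', s2') \<in> B\<inverse>))"
    using b unfolding p by simp
qed

lemma bisimulation_relcomp:
  assumes "bisimulation L G B" "bisimulation L G B'"
  shows "bisimulation L G (B O B')"
  unfolding bisimulation_def
proof (intro conjI ballI)
  show "B O B' \<subseteq> states L \<times> states L"
    using assms by (auto simp: bisimulation_def)
next
  fix p assume "p \<in> B O B'"
  then obtain s t u where p: "p = (s, u)" and st: "(s, t) \<in> B" and tu: "(t, u) \<in> B'"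
    by auto
  note b = bspec[OF assms(1)[unfolded bisimulation_def, THEN conjunct2] st, unfolded split]
  note b' = bspec[OF assms(2)[unfolded bisimulation_def, THEN conjunct2] tu, unfolded split]
  have fwd: "\<exists>u'\<in>states L. trans_eval L (moves L G) u u' \<and> (s', u') \<in> B O B'"
    if "s' \<in> states L" "trans_eval L (moves L G) s s'" for s'
    using b b' that by (meson relcomp.relcompI)
  have bwd: "\<exists>s'\<in>states L. trans_eval L (moves L G) s s' \<and> (s', u') \<in> B O B'"
    if "u' \<in> states L" "trans_eval L (moves L G) u u'" for u'
    using b b' that by (meson relcomp.relcompI)
  show "case p of (s1, s2) \<Rightarrow>
        (state_eval L (Goal G) s1 \<longleftrightarrow> state_eval L (Goal G) s2) \<and>
        (state_eval L (Init G) s1 \<longleftrightarrow> state_eval L (Init G) s2) \<and>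
        (r_holds L s1 \<longleftrightarrow> r_holds L s2) \<and>
        (\<forall>s1'\<in>states L. trans_eval L (moves L G) s1 s1' \<longrightarrow>
           (\<exists>s2'\<in>states L. trans_eval L (moves L G) s2 s2' \<and> (s1', s2') \<in> B O B')) \<and>
        (\<forall>s2'\<in>states L. trans_eval L (moves L G) s2 s2' \<longrightarrow>
           (\<exists>s1'\<in>states L. trans_eval L (moves L G) s1 s1' \<and> (s1', s2') \<in> B O B'))"
    using b b' fwd bwd unfolding p by simp
qed

lemma equiv_bisimilarity: "equiv (states L) (bisimilarity L G)"
proof (rule equivI)
  show "bisimilarity L G \<subseteq> states L \<times> states L"
    by (auto simp: bisimilarity_def bisimulation_def)
  show "refl_on (states L) (bisimilarity L G)"
    using bisimulation_Id_on by (fastforce simp: refl_on_def bisimilarity_def)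
  show "sym (bisimilarity L G)"
    unfolding sym_def bisimilarity_def using bisimulation_converse by fastforce
  show "trans (bisimilarity L G)"
    unfolding trans_def bisimilarity_def using bisimulation_relcomp by fast
qed

section \<open>Games over a fixed equivalence relation with finitely many classes\<close>

text \<open>\<open>B\<close> is not tied to a game: it will be the bisimilarity of the outermost
  game and stays the same in all recursive calls, although a subgame may have a different
  bisimilarity.\<close>

locale logic_with_classes = wf_logic L for L :: "('v::finite, 'd, 'f) logic" +
  fixes B :: "(('v \<Rightarrow> 'd) \<times> ('v \<Rightarrow> 'd)) set"
  assumes equiv: "equiv (states L) B"
    and finite_quotient: "finite (states L // B)"
    and r_holds_cong: "(s, t) \<in> B \<Longrightarrow> r_holds L s \<longleftrightarrow> r_holds L t"
begin

definition saturated :: "(('v \<Rightarrow> 'd) \<Rightarrow> bool) \<Rightarrow> bool" where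
  "saturated W \<longleftrightarrow> (\<forall>(s, t)\<in>B. W s \<longleftrightarrow> W t)"

text \<open>The second conjunct is a semantic substitute for \<open>state_pred\<close>. Unlike a
  bound on the free variables, it passes from a formula to any equivalent one, and interpolants are
  known only up to equivalence.\<close>

definition saturated_pred :: "'f \<Rightarrow> bool" where
  "saturated_pred \<phi> \<longleftrightarrow> saturated (state_eval L \<phi>) \<and>
     (\<forall>s\<in>states L. \<forall>s'\<in>states L. trans_eval L \<phi> s s' \<longleftrightarrow> state_eval L \<phi> s)"

text \<open>The part of bisimulation that is inherited by the subgames; it says nothing on \<open>Init\<close>.\<close>

definition compatible :: "'f game \<Rightarrow> bool" where
  "compatible G \<longleftrightarrow>
     saturated (state_eval L (Goal G)) \<and>
     (\<forall>s\<in>states L. \<forall>s'\<in>states L. trans_eval L (Safe G) s s' \<longrightarrow> \<not> r_holds L s) \<and>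
     (\<forall>s\<in>states L. \<forall>s'\<in>states L. trans_eval L (Reach G) s s' \<longrightarrow> r_holds L s) \<and>
     (\<forall>(s, t)\<in>B. \<forall>s'\<in>states L. trans_eval L (moves L G) s s' \<longrightarrow>
        (\<exists>t'\<in>states L. trans_eval L (moves L G) t t' \<and> (s', t') \<in> B))"

text \<open>Only moves are compared: a pair whose end points are equivalent to those of a move need
  not be a move, while \<open>F_sub\<close> holds on moves only. One implication suffices because
  \<open>B\<close> is symmetric.\<close>

definition respects_moves :: "'f game \<Rightarrow> 'f \<Rightarrow> bool" where
  "respects_moves G F \<longleftrightarrow> (\<forall>(s, t)\<in>B. \<forall>(s', t')\<in>B.
     trans_eval L (moves L G) s s' \<longrightarrow> trans_eval L (moves L G) t t' \<longrightarrow>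
     trans_eval L F s s' \<longrightarrow> trans_eval L F t t')"

text \<open>The invariant of the returned formula \<open>R\<close>. The factor \<open>Init G\<close>
  is split off because it may cut through a class.\<close>

definition init_saturated :: "'f game \<Rightarrow> 'f \<Rightarrow> bool" where
  "init_saturated G R \<longleftrightarrow>
     (\<exists>W. saturated W \<and> (\<forall>s\<in>states L. state_eval L R s \<longleftrightarrow> state_eval L (Init G) s \<and> W s))"

text \<open>The edges of the quotient graph; their number is the termination measure.\<close>

definition class_moves :: "'f game \<Rightarrow> (('v \<Rightarrow> 'd) set \<times> ('v \<Rightarrow> 'd) set) set" where
  "class_moves G = {(B `` {s}, B `` {s'}) | s s'.
     s \<in> states L \<and> s' \<in> states L \<and> trans_eval L (moves L G) s s'}"

lemma B_states: "(s, t) \<in> B \<Longrightarrow> s \<in> states L \<and> t \<in> states L"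
  using equiv by (meson equiv_class_eq_iff)

lemma B_sym: "(s, t) \<in> B \<Longrightarrow> (t, s) \<in> B"
  using equiv by (metis equiv_class_eq_iff)

lemma saturatedD: "saturated W \<Longrightarrow> (s, t) \<in> B \<Longrightarrow> W s \<longleftrightarrow> W t"
  by (auto simp: saturated_def)

lemma compatible_moveE:
  assumes "compatible G" "(s, t) \<in> B" "s' \<in> states L" "trans_eval L (moves L G) s s'"
  obtains t' where "t' \<in> states L" "trans_eval L (moves L G) t t'" "(s', t') \<in> B"
  using assms unfolding compatible_def by blast

lemma respects_movesD:
  assumes "respects_moves G F" "(s, t) \<in> B" "(s', t') \<in> B"
    "trans_eval L (moves L G) s s'" "trans_eval L (moves L G) t t'"
  shows "trans_eval L F s s' \<longleftrightarrow> trans_eval L F t t'"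
  using assms B_sym[OF assms(2)] B_sym[OF assms(3)] unfolding respects_moves_def by blast

lemma finite_class_moves: "finite (class_moves G)"
  by (rule finite_subset[of _ "(states L // B) \<times> (states L // B)"])
    (auto simp: class_moves_def finite_quotient intro: quotientI)

section \<open>The moves of the two subgames, and why the subgames stay compatible\<close>

lemma trans_eval_C_sub:
  assumes "saturated_pred (phi_itp L itp G)" "s \<in> states L" "s' \<in> states L"
  shows "trans_eval L (C_sub L itp G) s s' \<longleftrightarrow> trans_eval L (moves L G) s s' \<and>
    \<not> state_eval L (phi_itp L itp G) s \<and> state_eval L (phi_itp L itp G) s'"
  using assms
  by (auto simp: C_sub_def Instantiate_def trans_eval_simps trans_eval_Primed saturated_pred_def)

lemma trans_eval_moves_G_post:
  assumes "saturated_pred (phi_itp L itp G)" "s \<in> states L" "s' \<in> states L"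
  shows "trans_eval L (moves L (G_post L itp G)) s s' \<longleftrightarrow>
    trans_eval L (moves L G) s s' \<and> state_eval L (phi_itp L itp G) s"
  using assms by (auto simp: trans_eval_moves G_post_def trans_eval_simps saturated_pred_def)

lemma trans_eval_moves_G_pre:
  assumes "s \<in> states L" "s' \<in> states L"
  shows "trans_eval L (moves L (G_pre L itp G Rp)) s s' \<longleftrightarrow>
    trans_eval L (moves L G) s s' \<and> \<not> trans_eval L (F_fin L itp G Rp) s s'"
  using assms by (auto simp: trans_eval_moves G_pre_def trans_eval_simps)

text \<open>Whether a move survives depends only on the value of the interpolant at its source,
  which equivalent states share; so the matching move in \<open>G\<close> survives as well.\<close>

lemma compatible_G_post:
  assumes G: "compatible G" and \<phi>: "saturated_pred (phi_itp L itp G)"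
  shows "compatible (G_post L itp G)"
  unfolding compatible_def
proof (intro conjI)
  show "saturated (state_eval L (Goal (G_post L itp G)))"
    using G by (simp add: compatible_def G_post_def)
  show "\<forall>s\<in>states L. \<forall>s'\<in>states L. trans_eval L (Safe (G_post L itp G)) s s' \<longrightarrow> \<not> r_holds L s"
    "\<forall>s\<in>states L. \<forall>s'\<in>states L. trans_eval L (Reach (G_post L itp G)) s s' \<longrightarrow> r_holds L s"
    using G by (auto simp: compatible_def G_post_def trans_eval_simps)
  show "\<forall>(s, t)\<in>B. \<forall>s'\<in>states L. trans_eval L (moves L (G_post L itp G)) s s' \<longrightarrow>
        (\<exists>t'\<in>states L. trans_eval L (moves L (G_post L itp G)) t t' \<and> (s', t') \<in> B)"
  proof (clarify)
    fix s t s' assume st: "(s, t) \<in> B" and s': "s' \<in> states L"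
      and m: "trans_eval L (moves L (G_post L itp G)) s s'"
    note S = B_states[OF st]
    obtain t' where "t' \<in> states L" "trans_eval L (moves L G) t t'" "(s', t') \<in> B"
      using compatible_moveE[OF G st s'] m trans_eval_moves_G_post[OF \<phi>] S s' by blast
    moreover have "state_eval L (phi_itp L itp G) t"
      using m trans_eval_moves_G_post[OF \<phi>] S s' saturatedD[OF _ st] \<phi>
      unfolding saturated_pred_def by blast
    ultimately show "\<exists>t'\<in>states L. trans_eval L (moves L (G_post L itp G)) t t' \<and> (s', t') \<in> B"
      using trans_eval_moves_G_post[OF \<phi>] S by blast
  qed
qed

text \<open>The crucial point: \<open>Rp\<close> is not saturated, but on targets of
  \<open>C\<close> it coincides with the saturated \<open>W\<close>.\<close>

lemma respects_moves_F_sub: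
  assumes \<phi>: "saturated_pred (phi_itp L itp G)"
    and R: "init_saturated (G_post L itp G) Rp"
  shows "respects_moves G (F_sub L itp G Rp)"
  unfolding respects_moves_def
proof clarify
  fix s t s' t'
  assume st: "(s, t) \<in> B" and st': "(s', t') \<in> B"
    and ms: "trans_eval L (moves L G) s s'" and mt: "trans_eval L (moves L G) t t'"
    and F: "trans_eval L (F_sub L itp G Rp) s s'"
  note S = B_states[OF st] B_states[OF st']
  obtain W where W: "saturated W"
    and RW: "\<And>s. s \<in> states L \<Longrightarrow> state_eval L Rp s \<longleftrightarrow> state_eval L (Init (G_post L itp G)) s \<and> W s"
    using R unfolding init_saturated_def by blast
  have C: "trans_eval L (C_sub L itp G) s s'" and Rs: "state_eval L Rp s'"
    using F S by (auto simp: F_sub_def trans_eval_simps trans_eval_Primed)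
  have "saturated (state_eval L (phi_itp L itp G))"
    using \<phi> by (simp add: saturated_pred_def)
  from saturatedD[OF this st] saturatedD[OF this st'] have Ct: "trans_eval L (C_sub L itp G) t t'"
    using C mt S by (simp add: trans_eval_C_sub[OF \<phi>])
  \<comment> \<open>The initial condition of the post game holds exactly at the targets of
    \<open>C\<close>, and \<open>t\<close> is a source for \<open>t'\<close>. Hence no saturation of
    that condition is required.\<close>
  then have "state_eval L (Init (G_post L itp G)) t'"
    using S by (auto simp: G_post_def state_eval_Unprimed_Post)
  moreover have "W t'"
    using Rs RW S saturatedD[OF W st'] by blast
  ultimately show "trans_eval L (F_sub L itp G Rp) t t'"
    using Ct RW S by (simp add: F_sub_def trans_eval_simps trans_eval_Primed)
qed

text \<open>The disjunct that may be added tests \<open>Goal G\<close> at the target, and this is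
  saturated.\<close>

lemma respects_moves_F_fin:
  assumes G: "compatible G" and \<phi>: "saturated_pred (phi_itp L itp G)"
    and R: "init_saturated (G_post L itp G) Rp"
  shows "respects_moves G (F_fin L itp G Rp)"
  unfolding respects_moves_def
proof clarify
  fix s t s' t'
  assume st: "(s, t) \<in> B" and st': "(s', t') \<in> B"
    and ms: "trans_eval L (moves L G) s s'" and mt: "trans_eval L (moves L G) t t'"
    and F: "trans_eval L (F_fin L itp G Rp) s s'"
  have "saturated (state_eval L (Goal G))"
    using G by (simp add: compatible_def)
  from saturatedD[OF this st'] respects_movesD[OF respects_moves_F_sub[OF \<phi> R] st st' ms mt]
  show "trans_eval L (F_fin L itp G Rp) t t'"
    using F B_states[OF st] B_states[OF st']
    by (auto simp: F_fin_def trans_eval_simps trans_eval_Primed split: if_splits)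
qed

text \<open>The existential part of \<open>Enf\<close> is carried from \<open>s\<close> to
  \<open>t\<close> by matching a move forwards, the universal part by matching each
  \<open>Safe\<close> move of \<open>t\<close> back to a move of \<open>s\<close>.\<close>

lemma saturated_Pre_Enf:
  assumes G: "compatible G" and T: "respects_moves G T"
  shows "saturated (state_eval L (Pre L (Enf L T G)))"
proof -
  have eval: "state_eval L (Pre L (Enf L T G)) s \<longleftrightarrow> (\<exists>s'\<in>states L. trans_eval L (Enf L T G) s s')"
    if "s \<in> states L" for s
    using that by (simp add: state_eval_eq_trans_eval Pre_def trans_eval_Exq_Nxt)
  have imp: "state_eval L (Pre L (Enf L T G)) t"
    if st: "(s, t) \<in> B" and s: "state_eval L (Pre L (Enf L T G)) s" for s t
  proof -
    note S = B_states[OF st]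
    obtain s' where s': "s' \<in> states L" "trans_eval L (moves L G) s s'" "trans_eval L T s s'"
      and enf: "\<And>u. u \<in> states L \<Longrightarrow> trans_eval L (Safe G) s u \<Longrightarrow> trans_eval L T s u"
      using s S by (auto simp: eval trans_eval_Enf)
    obtain t' where t': "t' \<in> states L" "trans_eval L (moves L G) t t'" "(s', t') \<in> B"
      using compatible_moveE[OF G st s'(1,2)] by blast
    have "trans_eval L T t t'"
      using respects_movesD[OF T st t'(3) s'(2) t'(2)] s'(3) by simp
    moreover have "trans_eval L T t u" if u: "u \<in> states L" "trans_eval L (Safe G) t u" for u
    proof -
      have mu: "trans_eval L (moves L G) t u"
        using u S by (simp add: trans_eval_moves)
      then obtain v where v: "v \<in> states L" "trans_eval L (moves L G) s v" "(u, v) \<in> B"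
        using compatible_moveE[OF G B_sym[OF st] u(1)] by blast
      \<comment> \<open>Matching speaks of \<open>moves\<close> only. That the matched move of
        \<open>s\<close> is again a \<open>Safe\<close> move follows because \<open>r\<close> is
        false at \<open>t\<close>, hence at \<open>s\<close>, and every \<open>Reach\<close> move
        starts where \<open>r\<close> is true.\<close>
      have "\<not> r_holds L s"
        using G u S r_holds_cong[OF st] unfolding compatible_def by blast
      then have "trans_eval L (Safe G) s v"
        using G v S unfolding compatible_def by (auto simp: trans_eval_moves)
      then show ?thesis
        using enf v respects_movesD[OF T st B_sym[OF v(3)] v(2) mu] by simp
    qed
    ultimately show ?thesis
      using t' S by (auto simp: eval trans_eval_Enf)
  qed
  show ?thesis
    unfolding saturated_def using imp B_sym by blast
qed

text \<open>Matched moves are both in \<open>F\<close> or both outside it, so a surviving move is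
  matched by a surviving one.\<close>

lemma compatible_G_pre:
  assumes G: "compatible G" and F: "respects_moves G (F_fin L itp G Rp)"
  shows "compatible (G_pre L itp G Rp)"
  unfolding compatible_def
proof (intro conjI)
  show "saturated (state_eval L (Goal (G_pre L itp G Rp)))"
    using saturated_Pre_Enf[OF G F] by (simp add: G_pre_def)
  show "\<forall>s\<in>states L. \<forall>s'\<in>states L. trans_eval L (Safe (G_pre L itp G Rp)) s s' \<longrightarrow> \<not> r_holds L s"
    "\<forall>s\<in>states L. \<forall>s'\<in>states L. trans_eval L (Reach (G_pre L itp G Rp)) s s' \<longrightarrow> r_holds L s"
    using G by (auto simp: compatible_def G_pre_def trans_eval_simps)
  show "\<forall>(s, t)\<in>B. \<forall>s'\<in>states L. trans_eval L (moves L (G_pre L itp G Rp)) s s' \<longrightarrow>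
        (\<exists>t'\<in>states L. trans_eval L (moves L (G_pre L itp G Rp)) t t' \<and> (s', t') \<in> B)"
  proof (clarify)
    fix s t s' assume st: "(s, t) \<in> B" and s': "s' \<in> states L"
      and m: "trans_eval L (moves L (G_pre L itp G Rp)) s s'"
    note S = B_states[OF st]
    have ms: "trans_eval L (moves L G) s s'" "\<not> trans_eval L (F_fin L itp G Rp) s s'"
      using m trans_eval_moves_G_pre S s' by blast+
    obtain t' where t': "t' \<in> states L" "trans_eval L (moves L G) t t'" "(s', t') \<in> B"
      using compatible_moveE[OF G st s' ms(1)] by blast
    then have "\<not> trans_eval L (F_fin L itp G Rp) t t'"
      using respects_movesD[OF F st t'(3) ms(1) t'(2)] ms(2) by simp
    then show "\<exists>t'\<in>states L. trans_eval L (moves L (G_pre L itp G Rp)) t t' \<and> (s', t') \<in> B"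
      using t' trans_eval_moves_G_pre S by blast
  qed
qed

section \<open>Each recursive call loses a pair of classes\<close>

text \<open>A pair of classes disappears only when all moves between the two classes do; therefore
  \<open>lost\<close> ranges over all states equivalent to the end points.\<close>

lemma card_class_moves_less:
  assumes sub: "\<And>s s'. s \<in> states L \<Longrightarrow> s' \<in> states L \<Longrightarrow>
      trans_eval L (moves L G') s s' \<Longrightarrow> trans_eval L (moves L G) s s'"
    and s: "s \<in> states L" "s' \<in> states L" "trans_eval L (moves L G) s s'"
    and lost: "\<And>t t'. (s, t) \<in> B \<Longrightarrow> (s', t') \<in> B \<Longrightarrow> \<not> trans_eval L (moves L G') t t'"
  shows "card (class_moves G') < card (class_moves G)"
proof (rule psubset_card_mono[OF finite_class_moves])
  have "class_moves G' \<subseteq> class_moves G"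
    using sub by (fastforce simp: class_moves_def)
  moreover have "(B `` {s}, B `` {s'}) \<in> class_moves G"
    using s by (auto simp: class_moves_def)
  moreover have "(B `` {s}, B `` {s'}) \<notin> class_moves G'"
  proof
    assume "(B `` {s}, B `` {s'}) \<in> class_moves G'"
    then obtain t t' where t: "t \<in> states L" "t' \<in> states L" "trans_eval L (moves L G') t t'"
      and "B `` {s} = B `` {t}" "B `` {s'} = B `` {t'}"
      by (auto simp: class_moves_def)
    then have "(s, t) \<in> B" "(s', t') \<in> B"
      using s equiv by (meson equiv_class_eq_iff)+
    with lost t show False by blast
  qed
  ultimately show "class_moves G' \<subset> class_moves G" by blast
qed

text \<open>A move in \<open>C\<close> starts outside the interpolant, and so does every move whose
  source is in the same class; the post game keeps none of them.\<close>

lemma card_class_moves_G_post: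
  assumes \<phi>: "saturated_pred (phi_itp L itp G)"
    and C: "\<not> unsat L (Enf L (C_sub L itp G) G)"
  shows "card (class_moves (G_post L itp G)) < card (class_moves G)"
proof -
  obtain s s' where s: "s \<in> states L" "s' \<in> states L" "trans_eval L (moves L G) s s'"
    and n: "\<not> state_eval L (phi_itp L itp G) s"
    using C by (elim not_unsatE) (auto simp: trans_eval_Enf trans_eval_C_sub[OF \<phi>])
  have "saturated (state_eval L (phi_itp L itp G))"
    using \<phi> by (simp add: saturated_pred_def)
  then show ?thesis
    using n B_states
    by (intro card_class_moves_less[OF _ s]) (auto simp: trans_eval_moves_G_post[OF \<phi>] dest: saturatedD)
qed

lemma card_class_moves_G_pre:
  assumes F: "respects_moves G (F_fin L itp G Rp)"
    and sat: "\<not> unsat L (Enf L (F_sub L itp G Rp) G)"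
  shows "card (class_moves (G_pre L itp G Rp)) < card (class_moves G)"
proof -
  obtain s s' where s: "s \<in> states L" "s' \<in> states L" "trans_eval L (moves L G) s s'"
    and "trans_eval L (F_sub L itp G Rp) s s'"
    using sat by (elim not_unsatE) (auto simp: trans_eval_Enf)
  \<comment> \<open>The conditional reassignment only enlarges \<open>F\<close>, so the move found
    in \<open>F_sub\<close> is deleted too.\<close>
  then have Fs: "trans_eval L (F_fin L itp G Rp) s s'"
    by (simp add: F_fin_def trans_eval_simps)
  show ?thesis
  proof (rule card_class_moves_less[OF _ s])
    fix t t' assume t: "(s, t) \<in> B" "(s', t') \<in> B"
    show "\<not> trans_eval L (moves L (G_pre L itp G Rp)) t t'"
      using respects_movesD[OF F t s(3)] Fs B_states[OF t(1)] B_states[OF t(2)]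
      by (auto simp: trans_eval_moves_G_pre)
  qed (simp add: trans_eval_moves_G_pre)
qed

section \<open>The shape of the returned formula, and termination\<close>

lemma init_saturated_R_init:
  assumes "compatible G"
  shows "init_saturated G (R_init L G)"
  unfolding init_saturated_def using assms
  by (intro exI[of _ "state_eval L (Goal G)"])
    (auto simp: compatible_def R_init_def state_eval_eq_trans_eval trans_eval_simps)

text \<open>The pre game starts in \<open>Init\<close> without \<open>Goal\<close>, so the union of
  the two results is \<open>Init\<close> intersected with \<open>Goal\<close> or
  \<open>W\<close>.\<close>

lemma init_saturated_Dis_G_pre:
  assumes G: "compatible G" and R: "init_saturated (G_pre L itp G Rp) Rpre"
  shows "init_saturated G (Dis L (R_init L G) Rpre)"
proof -
  obtain W where W: "saturated W"
    and RW: "\<And>s. s \<in> states L \<Longrightarrow> state_eval L Rpre s \<longleftrightarrow> state_eval L (Init (G_pre L itp G Rp)) s \<and> W s"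
    using R unfolding init_saturated_def by blast
  have "saturated (state_eval L (Goal G))"
    using G by (simp add: compatible_def)
  with W have "saturated (\<lambda>s. state_eval L (Goal G) s \<or> W s)"
    unfolding saturated_def by blast
  moreover have "state_eval L (Dis L (R_init L G) Rpre) s \<longleftrightarrow>
      state_eval L (Init G) s \<and> (state_eval L (Goal G) s \<or> W s)" if "s \<in> states L" for s
    using RW[OF that] that
    by (auto simp: state_eval_eq_trans_eval G_pre_def I_init_def R_init_def trans_eval_simps)
  ultimately show ?thesis
    unfolding init_saturated_def by blast
qed

text \<open>The conclusion about \<open>R\<close> strengthens the induction: applied to the post
  call, it shows that \<open>F\<close> respects moves, on which both the compatibility and the
  smaller measure of the pre game rest.\<close>

lemma reach_run_terminates:
  assumes "compatible G"
    and "\<And>G'. (rec_call L itp)\<^sup>*\<^sup>* G G' \<Longrightarrow> \<not> unsat L (I_init L G') \<Longrightarrow> saturated_pred (phi_itp L itp G')"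
  shows "\<exists>R SR SS. reach_run L itp G (R, SR, SS) \<and> init_saturated G R"
  using assms
proof (induction "card (class_moves G)" arbitrary: G rule: less_induct)
  case less
  note G = less.prems(1)
  note R0 = init_saturated_R_init[OF G]
  \<comment> \<open>The hypothesis on interpolants covers all calls reachable from \<open>G\<close>,
    hence all those reachable from a direct call \<open>G'\<close>.\<close>
  have IH: "\<exists>R SR SS. reach_run L itp G' (R, SR, SS) \<and> init_saturated G' R"
    if "rec_call L itp G G'" "compatible G'" "card (class_moves G') < card (class_moves G)" for G'
    using less.hyps[OF that(3,2)] less.prems(2) converse_rtranclp_into_rtranclp[of "rec_call L itp", OF that(1)]
    by blast
  show ?case
  proof (cases "unsat L (I_init L G)")
    case True
    then show ?thesis using R0 reach_run.no_init by blast
  next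
    case I: False
    then have \<phi>: "saturated_pred (phi_itp L itp G)"
      using less.prems(2) by blast
    show ?thesis
    proof (cases "unsat L (Enf L (C_sub L itp G) G)")
      case True
      then show ?thesis using I R0 reach_run.no_enf_C by blast
    next
      case C: False
      obtain Rpost SRpost SSpost where post: "reach_run L itp (G_post L itp G) (Rpost, SRpost, SSpost)"
        and Rpost: "init_saturated (G_post L itp G) Rpost"
        using IH[OF rec_call.post[OF I C] compatible_G_post[OF G \<phi>] card_class_moves_G_post[OF \<phi> C]]
        by blast
      show ?thesis
      proof (cases "unsat L (Enf L (F_sub L itp G Rpost) G)")
        case True
        then show ?thesis using reach_run.no_enf_F[OF I C post] R0 by blast
      next
        case F: False
        note resp = respects_moves_F_fin[OF G \<phi> Rpost]
        obtain Rpre SRpre SSpre where pre: "reach_run L itp (G_pre L itp G Rpost) (Rpre, SRpre, SSpre)"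
          and "init_saturated (G_pre L itp G Rpost) Rpre"
          using IH[OF rec_call.pre[OF I C post F] compatible_G_pre[OF G resp]
              card_class_moves_G_pre[OF resp F]]
          by blast
        then show ?thesis
          using reach_run.recurse[OF I C post F pre] init_saturated_Dis_G_pre[OF G] by blast
      qed
    qed
  qed
qed

text \<open>Being saturated and ignoring the primed copy are semantic properties, preserved by
  disjunction and by equivalence.\<close>

lemma saturated_pred_disjunction_of:
  assumes "disjunction_of L \<Psi> \<theta>"
    and "\<And>\<psi>. \<psi> \<in> \<Psi> \<Longrightarrow> state_pred L \<psi>"
    and "\<And>\<psi>. \<psi> \<in> \<Psi> \<Longrightarrow> saturated (state_eval L \<psi>)"
  shows "saturated_pred \<theta>"
proof -
  obtain \<psi>s where \<psi>s: "set \<psi>s \<subseteq> \<Psi>" and eq: "equivalent L \<theta> (BigDis L \<psi>s)"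
    using assms(1) by (auto simp: disjunction_of_def)
  have te: "trans_eval L \<theta> s s' \<longleftrightarrow> (\<exists>\<psi>\<in>set \<psi>s. state_eval L \<psi> s)"
    if "s \<in> states L" "s' \<in> states L" for s s'
  proof -
    have "trans_eval L \<theta> s s' \<longleftrightarrow> (\<exists>\<psi>\<in>set \<psi>s. trans_eval L \<psi> s s')"
      using eq that by (simp add: equivalent_def trans_eval_def sat_BigDis)
    also have "\<dots> \<longleftrightarrow> (\<exists>\<psi>\<in>set \<psi>s. state_eval L \<psi> s)"
      using \<psi>s assms(2) that by (intro bex_cong) (auto simp: trans_eval_state_pred)
    finally show ?thesis .
  qed
  have "state_eval L \<theta> s \<longleftrightarrow> state_eval L \<theta> t" if st: "(s, t) \<in> B" for s t
    using te[of s s] te[of t t] B_states[OF st] \<psi>s assms(3) saturatedD[OF _ st]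
    unfolding state_eval_eq_trans_eval[of \<theta>] by blast
  then show ?thesis
    unfolding saturated_pred_def saturated_def
    using te by (auto simp: state_eval_eq_trans_eval)
qed

end

section \<open>Instantiation with the bisimilarity of the given game\<close>

theorem theorem3:
  fixes L :: "('v::finite, 'd, 'f) logic"
    and Interpolate :: "'f \<Rightarrow> 'f \<Rightarrow> 'f"
    and G :: "'f game"
    and n :: nat
    and S :: "nat \<Rightarrow> ('v \<Rightarrow> 'd) set"
    and \<psi> :: "nat \<Rightarrow> 'f"
  assumes "wf_logic L"
    and "interpolation L Interpolate"
    and "reachability_game L G"
    and "bij_betw S {1..n} (states L // bisimilarity L G)"
    and "\<And>i. i \<in> {1..n} \<Longrightarrow> state_pred L (\<psi> i)"
    and "\<And>i s. i \<in> {1..n} \<Longrightarrow> s \<in> states L \<Longrightarrow> state_eval L (\<psi> i) s \<longleftrightarrow> s \<in> S i"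
    and "itp_respects L Interpolate G (\<psi> ` {1..n})"
  shows "\<exists>res. reach_run L Interpolate G res"
proof -
  let ?B = "bisimilarity L G"
  note bisim = bisimulation_bisimilarity[of L G, unfolded bisimulation_def]
  interpret wf_logic L by fact
  interpret logic_with_classes L ?B
  proof
    show "equiv (states L) ?B" by (rule equiv_bisimilarity)
    show "finite (states L // ?B)"
      using assms(4) bij_betw_finite by blast
    show "r_holds L s \<longleftrightarrow> r_holds L t" if "(s, t) \<in> ?B" for s t
      using bisim that by blast
  qed
  \<comment> \<open>The clauses on \<open>Goal\<close> and on matching come from bisimilarity, those
    relating \<open>Safe\<close> and \<open>Reach\<close> to \<open>r\<close> from the definition of
    a reachability game.\<close>
  have compat: "compatible G"
    using assms(3) bisim unfolding compatible_def reachability_game_def saturated_def by blast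
  have sat_\<psi>: "saturated (state_eval L (\<psi> i))" if i: "i \<in> {1..n}" for i
  proof -
    \<comment> \<open>Each \<open>S i\<close> is an equivalence class and therefore closed under
      bisimilarity.\<close>
    have "S i \<in> states L // ?B"
      using assms(4) i by (auto dest: bij_betwE)
    then have "s \<in> S i \<longleftrightarrow> t \<in> S i" if "(s, t) \<in> ?B" for s t
      using equiv that by (meson B_sym in_quotient_imp_closed)
    then show ?thesis
      using assms(6)[OF i] B_states unfolding saturated_def by blast
  qed
  have "saturated_pred (phi_itp L Interpolate G')"
    if "(rec_call L Interpolate)\<^sup>*\<^sup>* G G'" "\<not> unsat L (I_init L G')" for G'
  proof (rule saturated_pred_disjunction_of)
    show "disjunction_of L (\<psi> ` {1..n}) (phi_itp L Interpolate G')"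
      using assms(7) that unfolding itp_respects_def itp_call_def phi_itp_def by blast
  qed (use assms(5) sat_\<psi> in auto)
  then show ?thesis
    using reach_run_terminates[OF compat] by blast
qed

end
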